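(* Let $(F,\Phi,\Psi)$ be a Drinfeld twist on a group $(G,m,e)$ with a braiding operator $r$. Then $(G,mF^{-1},e)$ is a group (with multiplication $mF^{-1}:G^2\to G$ and identity element $e$), and $FrF^{-1}$ is a braiding operator on it.
   Context: For a map $f:G^2\to G^2$, write $f_{12}=f\times\mathrm{id}_G$ and $f_{23}=\mathrm{id}_G\times f$ as maps $G^3\to G^3$. For a group $(G,m,e)$, $m_{12}(x,y,z)=(xy,z)$ and $m_{23}(x,y,z)=(x,yz)$. Juxtaposition of maps denotes composition. A braiding operator on a group $(G,m,e)$ is a map $r:G^2\to G^2$ satisfying $r(e,g)=(g,e)$, $r(g,e)=(e,g)$ for all $g$; $r m_{12}=m_{23}r_{12}r_{23}$; $r m_{23}=m_{12}r_{23}r_{12}$; and $mr=m$. (It is known that such $r$ is then an invertible map satisfying $r_{23}r_{12}r_{23}=r_{12}r_{23}r_{12}$.) A Drinfeld twist on a group $(G,m,e)$ with braiding operator $r$ is a triple of invertible maps $F:G^2\to G^2$, $\Phi,\Psi:G^3\to G^3$ satisfying (T1) $F_{12}\Psi=F_{23}\Phi$, (T2) $\Phi r_{23}=r_{23}\Phi$, (T3) $\Psi r_{12}=r_{12}\Psi$, and, for all $x,y,z\in G$, (G1) $\Psi(x,y,e)=(x,y,e)$ and $\Phi(e,x,y)=(e,x,y)$; (G2) $F(e,x)=(e,x)$ and $F(x,e)=(x,e)$; (G3) $m_{23}\Phi(x,y,z)=F(x,yz)$; (G4) $m_{12}\Psi(x,y,z)=F(xy,z)$. *)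

theory Defs
  imports "HOL-Algebra.Group"
begin

definition on12 :: "('a \<times> 'a \<Rightarrow> 'a \<times> 'a) \<Rightarrow> 'a \<times> 'a \<times> 'a \<Rightarrow> 'a \<times> 'a \<times> 'a" where
  "on12 f = (\<lambda>(x, y, z). case f (x, y) of (x', y') \<Rightarrow> (x', y', z))"

definition on23 :: "('a \<times> 'a \<Rightarrow> 'a \<times> 'a) \<Rightarrow> 'a \<times> 'a \<times> 'a \<Rightarrow> 'a \<times> 'a \<times> 'a" where
  "on23 f = (\<lambda>(x, y, z). (x, f (y, z)))"

definition mul :: "('a, 'b) monoid_scheme \<Rightarrow> 'a \<times> 'a \<Rightarrow> 'a" where
  "mul G = (\<lambda>(x, y). x \<otimes>\<^bsub>G\<^esub> y)"

definition mul12 :: "('a, 'b) monoid_scheme \<Rightarrow> 'a \<times> 'a \<times> 'a \<Rightarrow> 'a \<times> 'a" where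
  "mul12 G = (\<lambda>(x, y, z). (x \<otimes>\<^bsub>G\<^esub> y, z))"

definition mul23 :: "('a, 'b) monoid_scheme \<Rightarrow> 'a \<times> 'a \<times> 'a \<Rightarrow> 'a \<times> 'a" where
  "mul23 G = (\<lambda>(x, y, z). (x, y \<otimes>\<^bsub>G\<^esub> z))"

abbreviation carrier2 :: "('a, 'b) monoid_scheme \<Rightarrow> ('a \<times> 'a) set" where
  "carrier2 G \<equiv> carrier G \<times> carrier G"

abbreviation carrier3 :: "('a, 'b) monoid_scheme \<Rightarrow> ('a \<times> 'a \<times> 'a) set" where
  "carrier3 G \<equiv> carrier G \<times> carrier G \<times> carrier G"

text \<open>Equalities of maps are equalities of their values on the carrier powers; all maps are
  arbitrary elsewhere.\<close>

definition braiding_operator ::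
    "('a, 'b) monoid_scheme \<Rightarrow> ('a \<times> 'a \<Rightarrow> 'a \<times> 'a) \<Rightarrow> bool" where
  "braiding_operator G r \<longleftrightarrow>
     r \<in> carrier2 G \<rightarrow> carrier2 G \<and>
     (\<forall>g\<in>carrier G. r (\<one>\<^bsub>G\<^esub>, g) = (g, \<one>\<^bsub>G\<^esub>) \<and> r (g, \<one>\<^bsub>G\<^esub>) = (\<one>\<^bsub>G\<^esub>, g)) \<and>
     (\<forall>t\<in>carrier3 G. r (mul12 G t) = mul23 G (on12 r (on23 r t))) \<and>
     (\<forall>t\<in>carrier3 G. r (mul23 G t) = mul12 G (on23 r (on12 r t))) \<and>
     (\<forall>p\<in>carrier2 G. mul G (r p) = mul G p)"

definition drinfeld_twist ::
    "('a, 'b) monoid_scheme \<Rightarrow> ('a \<times> 'a \<Rightarrow> 'a \<times> 'a) \<Rightarrow> ('a \<times> 'a \<Rightarrow> 'a \<times> 'a) \<Rightarrow>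
     ('a \<times> 'a \<times> 'a \<Rightarrow> 'a \<times> 'a \<times> 'a) \<Rightarrow> ('a \<times> 'a \<times> 'a \<Rightarrow> 'a \<times> 'a \<times> 'a) \<Rightarrow> bool" where
  "drinfeld_twist G r F \<Phi> \<Psi> \<longleftrightarrow>
     bij_betw F (carrier2 G) (carrier2 G) \<and>
     bij_betw \<Phi> (carrier3 G) (carrier3 G) \<and>
     bij_betw \<Psi> (carrier3 G) (carrier3 G) \<and>
     (\<forall>t\<in>carrier3 G. on12 F (\<Psi> t) = on23 F (\<Phi> t)) \<and>
     (\<forall>t\<in>carrier3 G. \<Phi> (on23 r t) = on23 r (\<Phi> t)) \<and>
     (\<forall>t\<in>carrier3 G. \<Psi> (on12 r t) = on12 r (\<Psi> t)) \<and>
     (\<forall>x\<in>carrier G. \<forall>y\<in>carrier G.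
        \<Psi> (x, y, \<one>\<^bsub>G\<^esub>) = (x, y, \<one>\<^bsub>G\<^esub>) \<and> \<Phi> (\<one>\<^bsub>G\<^esub>, x, y) = (\<one>\<^bsub>G\<^esub>, x, y)) \<and>
     (\<forall>x\<in>carrier G. F (\<one>\<^bsub>G\<^esub>, x) = (\<one>\<^bsub>G\<^esub>, x) \<and> F (x, \<one>\<^bsub>G\<^esub>) = (x, \<one>\<^bsub>G\<^esub>)) \<and>
     (\<forall>x\<in>carrier G. \<forall>y\<in>carrier G. \<forall>z\<in>carrier G.
        mul23 G (\<Phi> (x, y, z)) = F (x, y \<otimes>\<^bsub>G\<^esub> z)) \<and>
     (\<forall>x\<in>carrier G. \<forall>y\<in>carrier G. \<forall>z\<in>carrier G.
        mul12 G (\<Psi> (x, y, z)) = F (x \<otimes>\<^bsub>G\<^esub> y, z))"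

definition twist_inv ::
    "('a, 'b) monoid_scheme \<Rightarrow> ('a \<times> 'a \<Rightarrow> 'a \<times> 'a) \<Rightarrow> 'a \<times> 'a \<Rightarrow> 'a \<times> 'a" where
  "twist_inv G F = inv_into (carrier2 G) F"

definition twisted_group ::
    "('a, 'b) monoid_scheme \<Rightarrow> ('a \<times> 'a \<Rightarrow> 'a \<times> 'a) \<Rightarrow> 'a monoid" where
  "twisted_group G F =
     \<lparr>carrier = carrier G, monoid.mult = (\<lambda>x y. mul G (twist_inv G F (x, y))), one = \<one>\<^bsub>G\<^esub>\<rparr>"

end

theory Submission
  imports Defs
begin

text \<open>
  Write \<open>m' = m F\<inverse>\<close> and \<open>r' = F r F\<inverse>\<close>. On pairs, \<open>F\<close> itself carries \<open>(m, r)\<close> to \<open>(m', r')\<close>: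
  \<open>m' F = m\<close> and \<open>r' F = F r\<close>. On triples there are two candidates for such a change of coordinates,
  \<open>F\<^sub>1\<^sub>2 \<Psi>\<close> and \<open>F\<^sub>2\<^sub>3 \<Phi>\<close>, and a twist makes them the same bijection \<open>T\<close> (\<open>twist3\<close> below). The form
  \<open>F\<^sub>1\<^sub>2 \<Psi>\<close> is the one suited to operations on the first two factors, since \<open>\<Psi>\<close> commutes with \<open>r\<^sub>1\<^sub>2\<close>
  and satisfies \<open>m\<^sub>1\<^sub>2 \<Psi> = F m\<^sub>1\<^sub>2\<close>; the form \<open>F\<^sub>2\<^sub>3 \<Phi>\<close> is suited to the last two. Hence \<open>T\<close>
  intertwines everything at once:
  \<open>m'\<^sub>1\<^sub>2 T = F m\<^sub>1\<^sub>2\<close>, \<open>m'\<^sub>2\<^sub>3 T = F m\<^sub>2\<^sub>3\<close>, \<open>r'\<^sub>1\<^sub>2 T = T r\<^sub>1\<^sub>2\<close>, \<open>r'\<^sub>2\<^sub>3 T = T r\<^sub>2\<^sub>3\<close>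
  (\<open>mul12_twist3\<close>, \<open>mul23_twist3\<close>, \<open>r'12_twist3\<close>, \<open>r'23_twist3\<close>).
  An identity between maps out of \<open>G\<^sup>3\<close> for \<open>m'\<close> and \<open>r'\<close> may be tested on the image of \<open>T\<close>, where
  these four rules reduce it to the same identity for \<open>m\<close> and \<open>r\<close>. This gives associativity and
  the two axioms relating \<open>r'\<close> to the product of two adjacent factors.

  Inverses do not come from such an identity. They are read off from \<open>T (x, x\<inverse>, x)\<close>: as
  \<open>m\<^sub>2\<^sub>3 \<Phi> (x, x\<inverse>, x) = F (x, e) = (x, e)\<close>, the triple \<open>\<Phi> (x, x\<inverse>, x)\<close> has the form \<open>(x, u, u\<inverse>)\<close>,
  and likewise \<open>\<Psi> (x, x\<inverse>, x) = (v, v\<inverse>, x)\<close>. The two forms of \<open>T\<close> then give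
  \<open>(F (v, v\<inverse>), x) = (x, F (u, u\<inverse>))\<close>. So \<open>F (u, u\<inverse>) = (w, x)\<close> for some \<open>w\<close>, and
  \<open>m' (w, x) = u u\<inverse> = e\<close>.
\<close>

section \<open>Acting on two adjacent factors of a triple\<close>

lemma on12_in_carrier3:
  assumes "f \<in> carrier2 G \<rightarrow> carrier2 G" "t \<in> carrier3 G"
  shows "on12 f t \<in> carrier3 G"
proof -
  obtain x y z where t: "t = (x, y, z)" by (cases t)
  have "f (x, y) \<in> carrier2 G" using assms t by blast
  then show ?thesis using assms(2) by (auto simp: t on12_def)
qed

lemma on23_in_carrier3:
  assumes "f \<in> carrier2 G \<rightarrow> carrier2 G" "t \<in> carrier3 G"
  shows "on23 f t \<in> carrier3 G"
proof -
  obtain x y z where t: "t = (x, y, z)" by (cases t)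
  have "f (y, z) \<in> carrier2 G" using assms t by blast
  then show ?thesis using assms(2) by (auto simp: t on23_def)
qed

lemma on12_intertwines:
  assumes "\<And>p. p \<in> carrier2 G \<Longrightarrow> f (g p) = h (k p)" "t \<in> carrier3 G"
  shows "on12 f (on12 g t) = on12 h (on12 k t)"
proof -
  obtain x y z where t: "t = (x, y, z)" by (cases t)
  have "f (g (x, y)) = h (k (x, y))" using assms t by simp
  then show ?thesis by (simp add: t on12_def case_prod_unfold)
qed

lemma on23_intertwines:
  assumes "\<And>p. p \<in> carrier2 G \<Longrightarrow> f (g p) = h (k p)" "t \<in> carrier3 G"
  shows "on23 f (on23 g t) = on23 h (on23 k t)"
  using assms by (cases t) (simp add: on23_def)

section \<open>The data of a twist\<close>

locale twisted_braided_group = group G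
  for G :: "('a, 'b) monoid_scheme" (structure) +
  fixes r F :: "'a \<times> 'a \<Rightarrow> 'a \<times> 'a"
    and \<Phi> \<Psi> :: "'a \<times> 'a \<times> 'a \<Rightarrow> 'a \<times> 'a \<times> 'a"
  assumes braiding: "braiding_operator G r"
    and twist: "drinfeld_twist G r F \<Phi> \<Psi>"
begin

abbreviation G' :: "'a monoid" where "G' \<equiv> twisted_group G F"

abbreviation r' :: "'a \<times> 'a \<Rightarrow> 'a \<times> 'a" where "r' \<equiv> F \<circ> r \<circ> twist_inv G F"

abbreviation twist3 :: "'a \<times> 'a \<times> 'a \<Rightarrow> 'a \<times> 'a \<times> 'a" where
  "twist3 t \<equiv> on12 F (\<Psi> t)"

lemma carrier_twisted [simp]: "carrier G' = carrier G"
  and one_twisted [simp]: "\<one>\<^bsub>G'\<^esub> = \<one>"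
  by (simp_all add: twisted_group_def)

lemma r_closed: "r \<in> carrier2 G \<rightarrow> carrier2 G"
  and r_unit: "g \<in> carrier G \<Longrightarrow> r (\<one>, g) = (g, \<one>)" "g \<in> carrier G \<Longrightarrow> r (g, \<one>) = (\<one>, g)"
  and r_mul12: "t \<in> carrier3 G \<Longrightarrow> r (mul12 G t) = mul23 G (on12 r (on23 r t))"
  and r_mul23: "t \<in> carrier3 G \<Longrightarrow> r (mul23 G t) = mul12 G (on23 r (on12 r t))"
  and mul_r: "p \<in> carrier2 G \<Longrightarrow> mul G (r p) = mul G p"
  \<comment> \<open>Quantifiers over pairs and triples must stay whole to match the variables \<open>t\<close> and \<open>p\<close>.\<close>
  using braiding unfolding braiding_operator_def by (simp_all del: split_paired_Ball_Sigma)

lemma F_bij: "bij_betw F (carrier2 G) (carrier2 G)"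
  and \<Phi>_bij: "bij_betw \<Phi> (carrier3 G) (carrier3 G)"
  and \<Psi>_bij: "bij_betw \<Psi> (carrier3 G) (carrier3 G)"
  and twist3_eq: "t \<in> carrier3 G \<Longrightarrow> twist3 t = on23 F (\<Phi> t)"
  and \<Phi>_r: "t \<in> carrier3 G \<Longrightarrow> \<Phi> (on23 r t) = on23 r (\<Phi> t)"
  and \<Psi>_r: "t \<in> carrier3 G \<Longrightarrow> \<Psi> (on12 r t) = on12 r (\<Psi> t)"
  and F_unit: "x \<in> carrier G \<Longrightarrow> F (\<one>, x) = (\<one>, x)" "x \<in> carrier G \<Longrightarrow> F (x, \<one>) = (x, \<one>)"
  using twist unfolding drinfeld_twist_def by (simp_all del: split_paired_Ball_Sigma)

lemma mul23_\<Phi>: "t \<in> carrier3 G \<Longrightarrow> mul23 G (\<Phi> t) = F (mul23 G t)"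
  using twist unfolding drinfeld_twist_def by (cases t) (simp add: mul23_def)

lemma mul12_\<Psi>: "t \<in> carrier3 G \<Longrightarrow> mul12 G (\<Psi> t) = F (mul12 G t)"
  using twist unfolding drinfeld_twist_def by (cases t) (simp add: mul12_def)

lemma F_closed: "F \<in> carrier2 G \<rightarrow> carrier2 G"
  and \<Phi>_closed: "t \<in> carrier3 G \<Longrightarrow> \<Phi> t \<in> carrier3 G"
  and \<Psi>_closed: "t \<in> carrier3 G \<Longrightarrow> \<Psi> t \<in> carrier3 G"
  using F_bij \<Phi>_bij \<Psi>_bij by (auto dest: bij_betw_imp_funcset)

lemma mul12_closed: "t \<in> carrier3 G \<Longrightarrow> mul12 G t \<in> carrier2 G"
  and mul23_closed: "t \<in> carrier3 G \<Longrightarrow> mul23 G t \<in> carrier2 G"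
  by (auto simp: mul12_def mul23_def)

section \<open>Change of coordinates on pairs and triples\<close>

lemma twist_inv_F: "p \<in> carrier2 G \<Longrightarrow> twist_inv G F (F p) = p"
  unfolding twist_inv_def using F_bij by (rule bij_betw_inv_into_left)

lemma pair_obtain_F:
  assumes "p \<in> carrier2 G"
  obtains q where "q \<in> carrier2 G" "p = F q"
  using assms bij_betw_imp_surj_on[OF F_bij] by blast

lemma mul_twisted_F: "p \<in> carrier2 G \<Longrightarrow> mul G' (F p) = mul G p"
proof -
  assume "p \<in> carrier2 G"
  moreover have "mul G' q = mul G (twist_inv G F q)" for q
    by (cases q) (simp add: mul_def twisted_group_def)
  ultimately show ?thesis by (simp only: twist_inv_F)
qed

lemma r'_F: "p \<in> carrier2 G \<Longrightarrow> r' (F p) = F (r p)"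
  by (simp add: twist_inv_F)

lemma mul12_twisted_on12_F:
  assumes "t \<in> carrier3 G"
  shows "mul12 G' (on12 F t) = mul12 G t"
proof -
  obtain x y z where t: "t = (x, y, z)" by (cases t)
  have "mul G' (F (x, y)) = mul G (x, y)" using assms t by (intro mul_twisted_F) auto
  then show ?thesis by (simp add: t on12_def mul12_def mul_def split: prod.splits)
qed

lemma mul23_twisted_on23_F:
  assumes "t \<in> carrier3 G"
  shows "mul23 G' (on23 F t) = mul23 G t"
proof -
  obtain x y z where t: "t = (x, y, z)" by (cases t)
  have "mul G' (F (y, z)) = mul G (y, z)" using assms t by (intro mul_twisted_F) auto
  then show ?thesis by (simp add: t on23_def mul23_def mul_def split: prod.splits)
qed

lemma triple_obtain_twist3:
  assumes "t \<in> carrier3 G"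
  obtains s where "s \<in> carrier3 G" "t = twist3 s"
proof -
  obtain x y z where t: "t = (x, y, z)" by (cases t)
  have "(x, y) \<in> carrier2 G" using assms t by simp
  then obtain q where q: "q \<in> carrier2 G" "(x, y) = F q" by (rule pair_obtain_F)
  have "t = on12 F (fst q, snd q, z)" by (simp add: t on12_def q(2)[symmetric])
  moreover have "(fst q, snd q, z) \<in> \<Psi> ` carrier3 G"
    unfolding bij_betw_imp_surj_on[OF \<Psi>_bij] using q(1) assms t by auto
  then obtain s where "s \<in> carrier3 G" "(fst q, snd q, z) = \<Psi> s" by (rule imageE)
  ultimately show ?thesis by (intro that[of s]) simp_all
qed

lemma mul12_twist3: "t \<in> carrier3 G \<Longrightarrow> mul12 G' (twist3 t) = F (mul12 G t)"
  by (simp add: mul12_twisted_on12_F \<Psi>_closed mul12_\<Psi>)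

lemma mul23_twist3: "t \<in> carrier3 G \<Longrightarrow> mul23 G' (twist3 t) = F (mul23 G t)"
  by (simp add: twist3_eq mul23_twisted_on23_F \<Phi>_closed mul23_\<Phi>)

lemma r'12_twist3: "t \<in> carrier3 G \<Longrightarrow> on12 r' (twist3 t) = twist3 (on12 r t)"
  by (simp only: \<Psi>_r on12_intertwines[of G r' F F r, OF r'_F \<Psi>_closed])

lemma r'23_twist3:
  assumes "t \<in> carrier3 G"
  shows "on23 r' (twist3 t) = twist3 (on23 r t)"
proof -
  have "on23 r' (twist3 t) = on23 r' (on23 F (\<Phi> t))"
    by (simp only: twist3_eq[OF assms])
  also have "\<dots> = on23 F (on23 r (\<Phi> t))"
    by (rule on23_intertwines[of G r' F F r, OF r'_F \<Phi>_closed[OF assms]])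
  also have "\<dots> = twist3 (on23 r t)"
    by (simp only: \<Phi>_r[OF assms] twist3_eq[OF on23_in_carrier3[OF r_closed assms]])
  finally show ?thesis .
qed

section \<open>The twisted group\<close>

lemma twisted_mult_closed:
  assumes "x \<in> carrier G" "y \<in> carrier G"
  shows "x \<otimes>\<^bsub>G'\<^esub> y \<in> carrier G"
proof -
  have "(x, y) \<in> carrier2 G" using assms by simp
  then obtain q where q: "q \<in> carrier2 G" "(x, y) = F q" by (rule pair_obtain_F)
  have "x \<otimes>\<^bsub>G'\<^esub> y = mul G' (F q)" by (simp add: mul_def q(2)[symmetric])
  also have "\<dots> = mul G q" by (rule mul_twisted_F[OF q(1)])
  finally show ?thesis using q(1) by (auto simp: mul_def)
qed

text \<open>In the coordinates given by \<open>T\<close>, both bracketings are the product of three elements of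
  \<open>G\<close>.\<close>

lemma twisted_mult_assoc:
  assumes "x \<in> carrier G" "y \<in> carrier G" "z \<in> carrier G"
  shows "(x \<otimes>\<^bsub>G'\<^esub> y) \<otimes>\<^bsub>G'\<^esub> z = x \<otimes>\<^bsub>G'\<^esub> (y \<otimes>\<^bsub>G'\<^esub> z)"
proof -
  have "(x, y, z) \<in> carrier3 G" using assms by simp
  then obtain s where s: "s \<in> carrier3 G" "(x, y, z) = twist3 s"
    by (rule triple_obtain_twist3)
  have "(x \<otimes>\<^bsub>G'\<^esub> y) \<otimes>\<^bsub>G'\<^esub> z = mul G' (mul12 G' (twist3 s))"
    by (simp add: mul_def mul12_def s(2)[symmetric])
  also have "\<dots> = mul G (mul12 G s)"
    by (simp add: mul12_twist3 s(1) mul_twisted_F mul12_closed)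
  also have "\<dots> = mul G (mul23 G s)"
    using s(1) by (auto simp: mul_def mul12_def mul23_def m_assoc)
  also have "\<dots> = mul G' (mul23 G' (twist3 s))"
    by (simp add: mul23_twist3 s(1) mul_twisted_F mul23_closed)
  also have "\<dots> = x \<otimes>\<^bsub>G'\<^esub> (y \<otimes>\<^bsub>G'\<^esub> z)"
    by (simp add: mul_def mul23_def s(2)[symmetric])
  finally show ?thesis .
qed

lemma twisted_l_one:
  assumes "x \<in> carrier G"
  shows "\<one> \<otimes>\<^bsub>G'\<^esub> x = x"
  using mul_twisted_F[of "(\<one>, x)"] assms by (simp add: F_unit mul_def)

text \<open>A left inverse of \<open>x\<close> is the first component of \<open>F (u, u\<inverse>)\<close>, where \<open>u\<close> is the middle
  component of \<open>\<Phi> (x, x\<inverse>, x)\<close>; comparing last components of the two forms of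
  \<open>T (x, x\<inverse>, x)\<close> shows that the second component of \<open>F (u, u\<inverse>)\<close> is \<open>x\<close>.\<close>

lemma twisted_l_inv_ex:
  assumes x: "x \<in> carrier G"
  shows "\<exists>w \<in> carrier G. w \<otimes>\<^bsub>G'\<^esub> x = \<one>"
proof -
  let ?t = "(x, inv x, x)"
  have t: "?t \<in> carrier3 G" using x by simp
  obtain a u u' where \<Phi>t: "\<Phi> ?t = (a, u, u')" by (cases "\<Phi> ?t")
  obtain v v' b where \<Psi>t: "\<Psi> ?t = (v, v', b)" by (cases "\<Psi> ?t")
  have u: "(u, u') \<in> carrier2 G" using \<Phi>_closed[OF t] \<Phi>t by simp
  have uu': "u \<otimes> u' = \<one>"
    using mul23_\<Phi>[OF t] x by (simp add: \<Phi>t mul23_def F_unit)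
  have b: "b = x"
    using mul12_\<Psi>[OF t] x by (simp add: \<Psi>t mul12_def F_unit)
  obtain w x' where wx': "F (u, u') = (w, x')" by (cases "F (u, u')")
  have "x' = x"
    using twist3_eq[OF t] wx' b
    by (simp add: \<Phi>t \<Psi>t on12_def on23_def split: prod.splits)
  then have "w \<otimes>\<^bsub>G'\<^esub> x = \<one>"
    using mul_twisted_F[OF u] uu' wx' by (simp add: mul_def)
  moreover have "w \<in> carrier G"
    using funcset_mem[OF F_closed u] wx' by simp
  ultimately show ?thesis by blast
qed

lemma group_twisted: "group G'"
  by (rule groupI)
    (simp_all add: twisted_mult_closed twisted_mult_assoc twisted_l_one twisted_l_inv_ex)

section \<open>The twisted braiding operator\<close>

lemma r'_closed: "r' \<in> carrier2 G \<rightarrow> carrier2 G"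
proof
  fix p assume "p \<in> carrier2 G"
  then obtain q where q: "q \<in> carrier2 G" "p = F q" by (rule pair_obtain_F)
  show "r' p \<in> carrier2 G"
    unfolding q(2) r'_F[OF q(1)] by (rule funcset_mem[OF F_closed funcset_mem[OF r_closed q(1)]])
qed

lemma r'_unit:
  assumes "g \<in> carrier G"
  shows "r' (\<one>, g) = (g, \<one>)" "r' (g, \<one>) = (\<one>, g)"
  using r'_F[of "(\<one>, g)"] r'_F[of "(g, \<one>)"] assms
  by (simp_all add: F_unit r_unit)

lemma mul_r':
  assumes "p \<in> carrier2 G"
  shows "mul G' (r' p) = mul G' p"
proof -
  obtain q where q: "q \<in> carrier2 G" "p = F q" using assms by (rule pair_obtain_F)
  show ?thesis
    unfolding q(2) r'_F[OF q(1)]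
    by (simp add: mul_twisted_F funcset_mem[OF r_closed] mul_r q(1))
qed

lemma r'_mul12:
  assumes "t \<in> carrier3 G"
  shows "r' (mul12 G' t) = mul23 G' (on12 r' (on23 r' t))"
proof -
  obtain s where s: "s \<in> carrier3 G" "t = twist3 s"
    using assms by (rule triple_obtain_twist3)
  note rs = on23_in_carrier3[OF r_closed s(1)]
  have "r' (mul12 G' t) = F (r (mul12 G s))"
    by (simp only: s(2) mul12_twist3[OF s(1)] r'_F[OF mul12_closed[OF s(1)]])
  also have "\<dots> = F (mul23 G (on12 r (on23 r s)))"
    by (simp only: r_mul12[OF s(1)])
  also have "\<dots> = mul23 G' (twist3 (on12 r (on23 r s)))"
    by (simp only: mul23_twist3[OF on12_in_carrier3[OF r_closed rs]])
  also have "\<dots> = mul23 G' (on12 r' (on23 r' t))"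
    by (simp only: s(2) r'23_twist3[OF s(1)] r'12_twist3[OF rs])
  finally show ?thesis .
qed

lemma r'_mul23:
  assumes "t \<in> carrier3 G"
  shows "r' (mul23 G' t) = mul12 G' (on23 r' (on12 r' t))"
proof -
  obtain s where s: "s \<in> carrier3 G" "t = twist3 s"
    using assms by (rule triple_obtain_twist3)
  note rs = on12_in_carrier3[OF r_closed s(1)]
  have "r' (mul23 G' t) = F (r (mul23 G s))"
    by (simp only: s(2) mul23_twist3[OF s(1)] r'_F[OF mul23_closed[OF s(1)]])
  also have "\<dots> = F (mul12 G (on23 r (on12 r s)))"
    by (simp only: r_mul23[OF s(1)])
  also have "\<dots> = mul12 G' (twist3 (on23 r (on12 r s)))"
    by (simp only: mul12_twist3[OF on23_in_carrier3[OF r_closed rs]])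
  also have "\<dots> = mul12 G' (on23 r' (on12 r' t))"
    by (simp only: s(2) r'12_twist3[OF s(1)] r'23_twist3[OF rs])
  finally show ?thesis .
qed

lemma braiding_operator_twisted: "braiding_operator G' r'"
  unfolding braiding_operator_def carrier_twisted one_twisted
  by (intro conjI ballI r'_closed r'_unit r'_mul12 r'_mul23 mul_r')

end

theorem theorem2p5:
  fixes G :: "('a, 'b) monoid_scheme"
    and r F :: "'a \<times> 'a \<Rightarrow> 'a \<times> 'a"
    and \<Phi> \<Psi> :: "'a \<times> 'a \<times> 'a \<Rightarrow> 'a \<times> 'a \<times> 'a"
  assumes "group G"
    and "braiding_operator G r"
    and "drinfeld_twist G r F \<Phi> \<Psi>"
  shows "group (twisted_group G F) \<and>
         braiding_operator (twisted_group G F) (F \<circ> r \<circ> twist_inv G F)"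
proof -
  interpret twisted_braided_group G r F \<Phi> \<Psi>
    using assms by (intro twisted_braided_group.intro twisted_braided_group_axioms.intro)
  show ?thesis using group_twisted braiding_operator_twisted by blast
qed

end
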